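(* Let $F$ be a field. The heptagon 4-cochain whose value on a double coloring $r=(r_1,r_2)$ of each simplex $\Delta^4$ is $Q_{\Delta^4}(\nu,\eta)$, where the 3-cocycles $\nu$ and $\eta$ represent $r_1$ and $r_2$, is a cocycle. Explicitly: for every 5-simplex $i_0\dots i_5$, every $F$-valued 3-cocycle $\omega$ on it with all components $\omega_{ijkl}\neq0$, and every pair $(r_1,r_2)$ of permitted colorings of this 5-simplex, $$\sum_{s=0}^{5}(-1)^s\,Q_{i_0\dots\widehat{i_s}\dots i_5}\bigl(\nu^{(s)},\eta^{(s)}\bigr)=0,$$ where $\nu^{(s)}$ and $\eta^{(s)}$ are any 3-cocycles on the face $i_0\dots\widehat{i_s}\dots i_5$ representing the colors of that face in $r_1$ and $r_2$ respectively.
   Context: Conventions. $i_0i_1\dots i_n$ denotes the $n$-simplex with vertices $i_0<i_1<\dots<i_n$; the simplicial coboundary is $(\delta\mu)_{i_0\dots i_{n+1}}=\sum_s(-1)^s\mu_{i_0\dots\widehat{i_s}\dots i_{n+1}}$. Colorings. The set of colors of a 4-simplex $\Delta^4$ (given $\omega$) is the space of $F$-valued 3-cocycles on $\Delta^4$ modulo multiples of $\omega|_{\Delta^4}$. A permitted coloring of a 5-simplex is an assignment of colors to its six 4-faces for which there is a single 3-cocycle on the 5-simplex whose restriction to each 4-face represents the color of that face. A double coloring is a pair $(r_1,r_2)$ of (permitted) colorings. The form $Q$. For 3-cocycles $\nu,\eta$ on $\Delta^4=ijklm$ put $\mu_{abcd}=\nu_{abcd}\,\eta_{abcd}/\omega_{abcd}$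 for each tetrahedron $abcd$, and $Q_{\Delta^4}(\nu,\eta)=(\delta\mu)(\Delta^4)=\frac{\nu_{jklm}\eta_{jklm}}{\omega_{jklm}}-\dots+\frac{\nu_{ijkl}\eta_{ijkl}}{\omega_{ijkl}}$. This value depends only on the classes of $\nu$ and $\eta$ modulo $\omega$. A heptagon $m$-cochain assigns values to (double) permitted colorings of $m$-simplices; its coboundary on a coloring of an $(m+1)$-simplex is the alternating sum over the faces, as written in the claim, and it is a cocycle if its coboundary vanishes. *)

theory Defs
  imports Main "HOL-Library.Sublist" "HOL-Library.FuncSet"
begin

text \<open>The simplex \<open>i\<^sub>0 \<dots> i\<^sub>n\<close> is the strictly increasing list of its vertices.\<close>

definition simplex :: "nat \<Rightarrow> 'v::linorder list \<Rightarrow> bool" where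
  "simplex n \<sigma> \<longleftrightarrow> length \<sigma> = Suc n \<and> sorted_wrt (<) \<sigma>"

definition faces :: "nat \<Rightarrow> 'v list \<Rightarrow> 'v list set" where
  "faces k \<sigma> = {\<tau>. subseq \<tau> \<sigma> \<and> length \<tau> = Suc k}"

definition omit :: "nat \<Rightarrow> 'v list \<Rightarrow> 'v list" where
  "omit s \<sigma> = take s \<sigma> @ drop (Suc s) \<sigma>"

definition coboundary :: "('v list \<Rightarrow> 'f::comm_ring_1) \<Rightarrow> 'v list \<Rightarrow> 'f" where
  "coboundary \<mu> \<sigma> = (\<Sum>s<length \<sigma>. (- 1) ^ s * \<mu> (omit s \<sigma>))"

text \<open>Cochains on \<open>\<sigma>\<close> are extensional, so that two of them are equal as soon as they agree on the
  faces of \<open>\<sigma>\<close>.\<close>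

definition cocycles :: "nat \<Rightarrow> 'v list \<Rightarrow> ('v list \<Rightarrow> 'f::comm_ring_1) set" where
  "cocycles k \<sigma> = {\<nu> \<in> extensional (faces k \<sigma>). \<forall>\<tau>\<in>faces (Suc k) \<sigma>. coboundary \<nu> \<tau> = 0}"

definition nowhere_zero_cocycles :: "'v list \<Rightarrow> ('v list \<Rightarrow> 'f::field) set" where
  "nowhere_zero_cocycles \<sigma> = {\<omega> \<in> cocycles 3 \<sigma>. \<forall>\<tau>\<in>faces 3 \<sigma>. \<omega> \<tau> \<noteq> 0}"

definition color_rel ::
  "('v list \<Rightarrow> 'f::field) \<Rightarrow> 'v list \<Rightarrow> (('v list \<Rightarrow> 'f) \<times> ('v list \<Rightarrow> 'f)) set" where
  "color_rel \<omega> \<sigma> = {(\<nu>, \<nu>'). \<nu> \<in> cocycles 3 \<sigma> \<and> \<nu>' \<in> cocycles 3 \<sigma> \<and>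
     (\<exists>c. \<forall>\<tau>\<in>faces 3 \<sigma>. \<nu>' \<tau> - \<nu> \<tau> = c * \<omega> \<tau>)}"

definition colors :: "('v list \<Rightarrow> 'f::field) \<Rightarrow> 'v list \<Rightarrow> ('v list \<Rightarrow> 'f) set set" where
  "colors \<omega> \<sigma> = cocycles 3 \<sigma> // color_rel \<omega> \<sigma>"

type_synonym ('v, 'f) coloring = "'v list \<Rightarrow> ('v list \<Rightarrow> 'f) set"

text \<open>Only the restriction of \<open>\<omega>\<close> to \<open>\<tau>\<close> enters in \<open>colors \<omega> \<tau>\<close>. On a 4-simplex, whose only 4-face
  is itself, every color gives a permitted coloring.\<close>

definition permitted_colorings ::
  "('v list \<Rightarrow> 'f::field) \<Rightarrow> 'v list \<Rightarrow> ('v, 'f) coloring set" where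
  "permitted_colorings \<omega> \<sigma> = {r \<in> (\<Pi>\<^sub>E \<tau>\<in>faces 4 \<sigma>. colors \<omega> \<tau>).
     \<exists>\<nu>\<in>cocycles 3 \<sigma>. \<forall>\<tau>\<in>faces 4 \<sigma>. restrict \<nu> (faces 3 \<tau>) \<in> r \<tau>}"

definition Q :: "('v list \<Rightarrow> 'f::field) \<Rightarrow> 'v list \<Rightarrow> ('v list \<Rightarrow> 'f) \<Rightarrow> ('v list \<Rightarrow> 'f) \<Rightarrow> 'f" where
  "Q \<omega> \<sigma> \<nu> \<eta> = coboundary (\<lambda>\<tau>. \<nu> \<tau> * \<eta> \<tau> / \<omega> \<tau>) \<sigma>"

text \<open>A heptagon cochain takes a simplex, the cocycle \<open>\<omega>\<close> on it and a double coloring of it. Its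
  values matter only for nowhere vanishing \<open>\<omega>\<close> and permitted colorings.\<close>

type_synonym ('v, 'f) heptagon_cochain =
  "'v list \<Rightarrow> ('v list \<Rightarrow> 'f) \<Rightarrow> ('v, 'f) coloring \<times> ('v, 'f) coloring \<Rightarrow> 'f"

definition heptagon_coboundary ::
  "('v, 'f::field) heptagon_cochain \<Rightarrow> ('v, 'f) heptagon_cochain" where
  "heptagon_coboundary f \<sigma> \<omega> = (\<lambda>(r\<^sub>1, r\<^sub>2).
     \<Sum>s<length \<sigma>. (- 1) ^ s * f (omit s \<sigma>) (restrict \<omega> (faces 3 (omit s \<sigma>)))
       (restrict r\<^sub>1 (faces 4 (omit s \<sigma>)), restrict r\<^sub>2 (faces 4 (omit s \<sigma>))))"

definition heptagon_cocycle :: "nat \<Rightarrow> ('v::linorder, 'f::field) heptagon_cochain \<Rightarrow> bool" where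
  "heptagon_cocycle m f \<longleftrightarrow>
     (\<forall>\<sigma> \<omega>. simplex (Suc m) \<sigma> \<longrightarrow> \<omega> \<in> nowhere_zero_cocycles \<sigma> \<longrightarrow>
       (\<forall>r \<in> permitted_colorings \<omega> \<sigma> \<times> permitted_colorings \<omega> \<sigma>.
          heptagon_coboundary f \<sigma> \<omega> r = 0))"

text \<open>The definite description is proper because \<open>Q \<omega> \<sigma> \<nu> \<eta>\<close> depends only on the classes of \<open>\<nu>\<close>
  and \<open>\<eta>\<close> modulo \<open>\<omega>\<close>.\<close>

definition Q_cochain :: "('v, 'f::field) heptagon_cochain" where
  "Q_cochain \<sigma> \<omega> = (\<lambda>(r\<^sub>1, r\<^sub>2). THE q. \<forall>\<nu>\<in>r\<^sub>1 \<sigma>. \<forall>\<eta>\<in>r\<^sub>2 \<sigma>. Q \<omega> \<sigma> \<nu> \<eta> = q)"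

end

theory Submission imports Defs begin

text \<open>If \<open>\<nu>\<close> and \<open>\<eta>\<close> are 3-cocycles on the whole 5-simplex, then \<open>Q\<close> on each 4-face is the coboundary
  of the one 3-cochain \<open>\<mu> = \<nu> \<eta> / \<omega>\<close>, so the claim is \<open>\<delta>\<delta>\<mu> = 0\<close>. Replacing \<open>\<nu>\<close> by \<open>\<nu> + c \<omega>\<close> on a
  4-face changes \<open>\<mu>\<close> by \<open>c \<eta>\<close>, hence \<open>Q\<close> by \<open>c \<delta>\<eta> = 0\<close>; so arbitrary representatives of the colors
  may be exchanged for restrictions of global cocycles.\<close>

section \<open>Deleting vertices, and faces of faces\<close>

lemma length_omit: "s < length \<sigma> \<Longrightarrow> length (omit s \<sigma>) = length \<sigma> - 1"
  by (simp add: omit_def)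

text \<open>The simplicial identity behind \<delta>\<delta> = 0: once the vertex at \<open>t\<close>
  is deleted, the one formerly at \<open>Suc s\<close> sits at position \<open>s\<close>.\<close>

lemma omit_omit: "t \<le> s \<Longrightarrow> omit t (omit (Suc s) \<sigma>) = omit s (omit t \<sigma>)"
proof (induction \<sigma> arbitrary: s t)
  case Nil
  then show ?case by (simp add: omit_def)
next
  case (Cons a \<sigma>)
  then show ?case by (cases t; cases s) (auto simp: omit_def)
qed

lemma subseq_omit: "subseq (omit s \<sigma>) \<sigma>"
proof -
  have "subseq (take s \<sigma> @ drop (Suc s) \<sigma>) (take s \<sigma> @ drop s \<sigma>)"
    using suffix_imp_subseq[OF suffix_drop[of 1 "drop s \<sigma>"]]
    by (intro list_emb_append_mono) simp_all
  then show ?thesis by (simp add: omit_def)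
qed

lemma omit_in_faces: "length \<sigma> = Suc (Suc k) \<Longrightarrow> s < length \<sigma> \<Longrightarrow> omit s \<sigma> \<in> faces k \<sigma>"
  by (simp add: faces_def subseq_omit length_omit)

lemma faces_trans: "\<tau> \<in> faces k \<sigma> \<Longrightarrow> faces j \<tau> \<subseteq> faces j \<sigma>"
  by (auto simp: faces_def intro: subseq_order.trans)

lemma self_in_faces: "length \<sigma> = Suc k \<Longrightarrow> \<sigma> \<in> faces k \<sigma>"
  by (simp add: faces_def)

section \<open>The coboundary and its square\<close>

lemma coboundary_cong:
  assumes "length \<sigma> = Suc (Suc k)" and "\<And>\<tau>. \<tau> \<in> faces k \<sigma> \<Longrightarrow> \<mu> \<tau> = \<mu>' \<tau>"
  shows "coboundary \<mu> \<sigma> = coboundary \<mu>' \<sigma>"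
  unfolding coboundary_def
  using assms by (intro sum.cong) (auto simp: omit_in_faces)

lemma coboundary_linear:
  "coboundary (\<lambda>\<tau>. \<mu> \<tau> + c * \<mu>' \<tau>) \<sigma> = coboundary \<mu> \<sigma> + c * coboundary \<mu>' \<sigma>"
  by (simp add: coboundary_def sum.distrib sum_distrib_left algebra_simps)

text \<open>Each pair of vertices is deleted in two orders. Both orders give the same list, but the
  later vertex has its index lowered by one in one of them, so the signs are opposite and the two
  terms cancel.\<close>

lemma coboundary_coboundary:
  fixes \<mu> :: "'v list \<Rightarrow> 'f::comm_ring_1"
  shows "coboundary (coboundary \<mu>) \<sigma> = 0"
proof (cases "length \<sigma>")
  case 0
  then show ?thesis by (simp add: coboundary_def)
next
  case (Suc n)
  define g where "g s t = (- 1) ^ (s + t) * \<mu> (omit t (omit s \<sigma>))" for s t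
  \<comment> \<open>In \<open>U\<close> the second deletion lies before the first. In
    \<open>L\<close> it lies at or after it, where indices refer to the already shortened list;
    hence \<open>t = s\<close> belongs to \<open>L\<close>.\<close>
  define U where "U = (SIGMA s:{..<Suc n}. {..<n} \<inter> {t. t < s})"
  define L where "L = (SIGMA s:{..<Suc n}. {..<n} \<inter> {t. \<not> t < s})"
  have "coboundary (coboundary \<mu>) \<sigma> = (\<Sum>s<Suc n. \<Sum>t<n. g s t)"
    unfolding coboundary_def
    by (simp add: Suc length_omit g_def sum_distrib_left power_add mult.assoc)
  also have "\<dots> = (\<Sum>(s, t)\<in>(SIGMA s:{..<Suc n}. {..<n}). g s t)"
    by (rule sum.Sigma) auto
  also have "(SIGMA s:{..<Suc n}. {..<n}) = U \<union> L"
    by (auto simp: U_def L_def)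
  also have "(\<Sum>(s, t)\<in>U \<union> L. g s t) = (\<Sum>(s, t)\<in>U. g s t) + (\<Sum>(s, t)\<in>L. g s t)"
    by (rule sum.union_disjoint) (auto simp: U_def L_def)
  also have "(\<Sum>(s, t)\<in>U. g s t) = (\<Sum>(s, t)\<in>L. - g s t)"
  \<comment> \<open>Swapping the order of deletion: deleting at \<open>s\<close> and then at
    \<open>t < s\<close> amounts to deleting at \<open>t\<close> and then at
    \<open>s - 1\<close>.\<close>
  proof (rule sum.reindex_bij_witness[of _ "\<lambda>(s, t). (Suc t, s)" "\<lambda>(s, t). (t, s - 1)"])
    fix p assume "p \<in> U"
    \<comment> \<open>In \<open>U\<close> the first index exceeds \<open>t\<close>, hence is a
      successor, so the natural-number subtraction \<open>s - 1\<close> does not truncate.\<close>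
    then obtain s t where p: "p = (Suc s, t)" "t \<le> s" "s < n"
      by (cases p; cases "fst p") (auto simp: U_def)
    then show "(case case p of (s, t) \<Rightarrow> (t, s - 1) of (s, t) \<Rightarrow> - g s t) = (case p of (s, t) \<Rightarrow> g s t)"
      by (simp add: g_def omit_omit add.commute)
  qed (auto simp: U_def L_def)
  finally show ?thesis
    by (simp add: case_prod_unfold sum_negf)
qed

lemma coboundary_cocycle:
  assumes "\<nu> \<in> cocycles k \<sigma>" and "length \<sigma> = Suc (Suc k)"
  shows "coboundary \<nu> \<sigma> = 0"
  using assms by (simp add: cocycles_def self_in_faces)

section \<open>Colors as classes, and independence of \<open>Q\<close> from representatives\<close>

lemma equiv_color_rel: "equiv (cocycles 3 \<sigma>) (color_rel \<omega> \<sigma>)"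
proof (rule equivI)
  show "color_rel \<omega> \<sigma> \<subseteq> cocycles 3 \<sigma> \<times> cocycles 3 \<sigma>"
    by (auto simp: color_rel_def)
  show "refl_on (cocycles 3 \<sigma>) (color_rel \<omega> \<sigma>)"
    by (auto simp: refl_on_def color_rel_def intro: exI[of _ 0])
  show "sym (color_rel \<omega> \<sigma>)"
  proof (rule symI)
    fix \<nu> \<nu>' assume "(\<nu>, \<nu>') \<in> color_rel \<omega> \<sigma>"
    then obtain c where "\<forall>\<tau>\<in>faces 3 \<sigma>. \<nu>' \<tau> - \<nu> \<tau> = c * \<omega> \<tau>"
      and "\<nu> \<in> cocycles 3 \<sigma>" "\<nu>' \<in> cocycles 3 \<sigma>"
      by (auto simp: color_rel_def)
    then show "(\<nu>', \<nu>) \<in> color_rel \<omega> \<sigma>"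
      by (auto simp: color_rel_def algebra_simps intro!: exI[of _ "- c"])
  qed
  show "trans (color_rel \<omega> \<sigma>)"
  proof (rule transI)
    fix \<nu> \<nu>' \<nu>'' assume "(\<nu>, \<nu>') \<in> color_rel \<omega> \<sigma>" "(\<nu>', \<nu>'') \<in> color_rel \<omega> \<sigma>"
    then obtain c d where "\<forall>\<tau>\<in>faces 3 \<sigma>. \<nu>' \<tau> - \<nu> \<tau> = c * \<omega> \<tau>"
      and "\<forall>\<tau>\<in>faces 3 \<sigma>. \<nu>'' \<tau> - \<nu>' \<tau> = d * \<omega> \<tau>"
      and "\<nu> \<in> cocycles 3 \<sigma>" "\<nu>'' \<in> cocycles 3 \<sigma>"
      by (auto simp: color_rel_def)
    then show "(\<nu>, \<nu>'') \<in> color_rel \<omega> \<sigma>"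
      by (auto simp: color_rel_def algebra_simps intro!: exI[of _ "c + d"])
  qed
qed

text \<open>Turns membership in a common class into an explicit shift by a multiple of \<omega>, the
  form in which \<open>Q\<close> can be compared.\<close>

lemma color_rel_if_same_color:
  "r \<in> colors \<omega> \<sigma> \<Longrightarrow> \<nu> \<in> r \<Longrightarrow> \<nu>' \<in> r \<Longrightarrow> (\<nu>, \<nu>') \<in> color_rel \<omega> \<sigma>"
  unfolding colors_def using equiv_color_rel quotient_eq_iff by fast

lemma Q_commute: "Q \<omega> \<sigma> \<nu> \<eta> = Q \<omega> \<sigma> \<eta> \<nu>"
  by (simp add: Q_def mult.commute)

lemma Q_cong_left:
  assumes len: "length \<sigma> = 5" and nz: "\<And>\<tau>. \<tau> \<in> faces 3 \<sigma> \<Longrightarrow> \<omega> \<tau> \<noteq> 0"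
    and \<nu>: "(\<nu>, \<nu>') \<in> color_rel \<omega> \<sigma>" and \<eta>: "\<eta> \<in> cocycles 3 \<sigma>"
  shows "Q \<omega> \<sigma> \<nu>' \<eta> = Q \<omega> \<sigma> \<nu> \<eta>"
proof -
  obtain c where c: "\<And>\<tau>. \<tau> \<in> faces 3 \<sigma> \<Longrightarrow> \<nu>' \<tau> - \<nu> \<tau> = c * \<omega> \<tau>"
    using \<nu> by (auto simp: color_rel_def)
  have "Q \<omega> \<sigma> \<nu>' \<eta> = coboundary (\<lambda>\<tau>. \<nu> \<tau> * \<eta> \<tau> / \<omega> \<tau> + c * \<eta> \<tau>) \<sigma>"
    unfolding Q_def
  proof (rule coboundary_cong[where k = 3])
    fix \<tau> assume \<tau>: "\<tau> \<in> faces 3 \<sigma>"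
    have "\<nu>' \<tau> = \<nu> \<tau> + c * \<omega> \<tau>"
      using c[OF \<tau>] by (simp add: algebra_simps)
    \<comment> \<open>Here \<omega> must not vanish: the shift contributes c \<omega> \<eta> /
      \<omega>, and cancelling leaves c \<eta>.\<close>
    then show "\<nu>' \<tau> * \<eta> \<tau> / \<omega> \<tau> = \<nu> \<tau> * \<eta> \<tau> / \<omega> \<tau> + c * \<eta> \<tau>"
      using nz[OF \<tau>] by (simp add: field_simps)
  qed (use len in simp)
  also have "\<dots> = Q \<omega> \<sigma> \<nu> \<eta>"
    using coboundary_cocycle[OF \<eta>] len by (simp add: coboundary_linear Q_def)
  finally show ?thesis .
qed

lemma Q_well_defined:
  assumes "length \<sigma> = 5" and "\<And>\<tau>. \<tau> \<in> faces 3 \<sigma> \<Longrightarrow> \<omega> \<tau> \<noteq> 0"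
    and "r\<^sub>1 \<in> colors \<omega> \<sigma>" "r\<^sub>2 \<in> colors \<omega> \<sigma>"
    and "\<nu> \<in> r\<^sub>1" "\<nu>' \<in> r\<^sub>1" "\<eta> \<in> r\<^sub>2" "\<eta>' \<in> r\<^sub>2"
  shows "Q \<omega> \<sigma> \<nu>' \<eta>' = Q \<omega> \<sigma> \<nu> \<eta>"
proof -
  have \<nu>: "(\<nu>, \<nu>') \<in> color_rel \<omega> \<sigma>" and \<eta>: "(\<eta>, \<eta>') \<in> color_rel \<omega> \<sigma>"
    using assms color_rel_if_same_color by blast+
  \<comment> \<open>One argument is exchanged at a time, passing through
    \<open>Q \<omega> \<sigma> \<nu> \<eta>'\<close>; the second exchange uses the symmetry of
    \<open>Q\<close>. The argument that stays fixed has to be a cocycle: \<eta>' first, then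
    \<nu>.\<close>
  then have "\<nu> \<in> cocycles 3 \<sigma>" "\<eta>' \<in> cocycles 3 \<sigma>"
    by (auto simp: color_rel_def)
  then show ?thesis
    using Q_cong_left[of \<sigma> \<omega>, OF assms(1,2) \<nu>] Q_cong_left[of \<sigma> \<omega>, OF assms(1,2) \<eta>] Q_commute by metis
qed

lemma Q_cochain_eq:
  assumes "length \<sigma> = 5" and "\<And>\<tau>. \<tau> \<in> faces 3 \<sigma> \<Longrightarrow> \<omega> \<tau> \<noteq> 0"
    and "r\<^sub>1 \<sigma> \<in> colors \<omega> \<sigma>" "r\<^sub>2 \<sigma> \<in> colors \<omega> \<sigma>" and "\<nu> \<in> r\<^sub>1 \<sigma>" "\<eta> \<in> r\<^sub>2 \<sigma>"
  shows "Q_cochain \<sigma> \<omega> (r\<^sub>1, r\<^sub>2) = Q \<omega> \<sigma> \<nu> \<eta>"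
  unfolding Q_cochain_def prod.case
proof (rule the_equality)
  show "\<forall>\<nu>'\<in>r\<^sub>1 \<sigma>. \<forall>\<eta>'\<in>r\<^sub>2 \<sigma>. Q \<omega> \<sigma> \<nu>' \<eta>' = Q \<omega> \<sigma> \<nu> \<eta>"
    using Q_well_defined[of \<sigma> \<omega>, OF assms(1,2)] assms(3-6) by blast
\<comment> \<open>Uniqueness: \<nu> and \<eta> inhabit the two classes, so the condition in the
  description is not vacuous and determines \<open>q\<close>.\<close>
qed (use assms(5,6) in auto)

section \<open>Passage to faces and the alternating sum\<close>

lemma colors_restrict:
  assumes "faces 3 \<tau> \<subseteq> A"
  shows "colors (restrict \<omega> A) \<tau> = colors \<omega> \<tau>"
proof -
  have "color_rel (restrict \<omega> A) \<tau> = color_rel \<omega> \<tau>"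
    using assms by (simp add: color_rel_def subset_iff)
  then show ?thesis by (simp add: colors_def)
qed

lemma Q_restrict:
  assumes "length \<tau> = 5" and "faces 3 \<tau> \<subseteq> A" "faces 3 \<tau> \<subseteq> B" "faces 3 \<tau> \<subseteq> C"
  shows "Q (restrict \<omega> A) \<tau> (restrict \<nu> B) (restrict \<eta> C) = Q \<omega> \<tau> \<nu> \<eta>"
  unfolding Q_def by (rule coboundary_cong[where k = 3]) (use assms in auto)

lemma permitted_coloringsD:
  assumes "r \<in> permitted_colorings \<omega> \<sigma>" and "\<tau> \<in> faces 4 \<sigma>"
  shows "r \<tau> \<in> colors \<omega> \<tau>"
  using assms by (auto simp: permitted_colorings_def)

text \<open>Allowing an arbitrary choice of representatives on each face makes this serve both the
  explicit sum and the coboundary of \<open>Q_cochain\<close>.\<close>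

lemma alternating_sum_Q_eq_0:
  fixes \<sigma> :: "'v list" and \<omega> :: "'v list \<Rightarrow> 'f::field"
  assumes len: "length \<sigma> = 6" and \<omega>: "\<omega> \<in> nowhere_zero_cocycles \<sigma>"
    and r: "r\<^sub>1 \<in> permitted_colorings \<omega> \<sigma>" "r\<^sub>2 \<in> permitted_colorings \<omega> \<sigma>"
    and rep: "\<And>s. s < 6 \<Longrightarrow> \<nu> s \<in> r\<^sub>1 (omit s \<sigma>) \<and> \<eta> s \<in> r\<^sub>2 (omit s \<sigma>)"
  shows "(\<Sum>s<6. (- 1) ^ s *
    Q (restrict \<omega> (faces 3 (omit s \<sigma>))) (omit s \<sigma>) (\<nu> s) (\<eta> s)) = 0"
proof -
  \<comment> \<open>Permittedness supplies one cocycle on the whole 5-simplex for each coloring,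
    independent of \<open>s\<close>.\<close>
  obtain \<nu>' \<eta>' where
      \<nu>': "\<And>\<tau>. \<tau> \<in> faces 4 \<sigma> \<Longrightarrow> restrict \<nu>' (faces 3 \<tau>) \<in> r\<^sub>1 \<tau>"
    and \<eta>': "\<And>\<tau>. \<tau> \<in> faces 4 \<sigma> \<Longrightarrow> restrict \<eta>' (faces 3 \<tau>) \<in> r\<^sub>2 \<tau>"
    using r unfolding permitted_colorings_def by blast
  have "Q (restrict \<omega> (faces 3 (omit s \<sigma>))) (omit s \<sigma>) (\<nu> s) (\<eta> s)
      = coboundary (\<lambda>\<tau>. \<nu>' \<tau> * \<eta>' \<tau> / \<omega> \<tau>) (omit s \<sigma>)" if s: "s < 6" for s
  proof -
    let ?\<tau> = "omit s \<sigma>"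
    let ?\<omega> = "restrict \<omega> (faces 3 ?\<tau>)"
    have \<tau>: "?\<tau> \<in> faces 4 \<sigma>" and len\<tau>: "length ?\<tau> = 5"
      using s len by (simp_all add: omit_in_faces length_omit)
    have nz: "?\<omega> \<rho> \<noteq> 0" if "\<rho> \<in> faces 3 ?\<tau>" for \<rho>
      using that \<omega> faces_trans[OF \<tau>] by (auto simp: nowhere_zero_cocycles_def)
    \<comment> \<open>The colorings are defined with \<omega> on the whole of \<sigma>, the form on
      the face with its restriction; the colors are the same, since only values on 3-faces of the
      face enter.\<close>
    have "r\<^sub>1 ?\<tau> \<in> colors ?\<omega> ?\<tau>" "r\<^sub>2 ?\<tau> \<in> colors ?\<omega> ?\<tau>"
      using r \<tau> by (simp_all add: colors_restrict permitted_coloringsD)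
    then have "Q ?\<omega> ?\<tau> (\<nu> s) (\<eta> s)
        = Q ?\<omega> ?\<tau> (restrict \<nu>' (faces 3 ?\<tau>)) (restrict \<eta>' (faces 3 ?\<tau>))"
      using Q_well_defined[of ?\<tau> ?\<omega>, OF len\<tau> nz] rep[OF s] \<nu>'[OF \<tau>] \<eta>'[OF \<tau>] by blast
    \<comment> \<open>Dropping the restrictions leaves a 3-cochain \<nu>' \<eta>' / \<omega> that is
      the same for every face, as \<delta>\<delta> = 0 requires.\<close>
    also have "\<dots> = Q \<omega> ?\<tau> \<nu>' \<eta>'"
      by (rule Q_restrict) (simp_all add: len\<tau>)
    finally show ?thesis by (simp add: Q_def)
  qed
  then have "(\<Sum>s<6. (- 1) ^ s * Q (restrict \<omega> (faces 3 (omit s \<sigma>))) (omit s \<sigma>) (\<nu> s) (\<eta> s))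
      = coboundary (coboundary (\<lambda>\<tau>. \<nu>' \<tau> * \<eta>' \<tau> / \<omega> \<tau>)) \<sigma>"
    \<comment> \<open>The instantiation expands only the outer coboundary, so the inner one stays in
      the form of the face values just computed.\<close>
    unfolding coboundary_def[of "coboundary _"] len by simp
  then show ?thesis by (simp add: coboundary_coboundary)
qed

lemma heptagon_coboundary_Q_cochain:
  fixes \<sigma> :: "'v list" and \<omega> :: "'v list \<Rightarrow> 'f::field"
  assumes len: "length \<sigma> = 6" and \<omega>: "\<omega> \<in> nowhere_zero_cocycles \<sigma>"
    and r: "r\<^sub>1 \<in> permitted_colorings \<omega> \<sigma>" "r\<^sub>2 \<in> permitted_colorings \<omega> \<sigma>"
  shows "heptagon_coboundary Q_cochain \<sigma> \<omega> (r\<^sub>1, r\<^sub>2) = 0"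
proof -
  \<comment> \<open>Every color here contains the restriction of a global cocycle, so
    representatives can be chosen face by face.\<close>
  have "\<exists>\<nu> \<eta>. \<nu> \<in> r\<^sub>1 (omit s \<sigma>) \<and> \<eta> \<in> r\<^sub>2 (omit s \<sigma>)" if "s < 6" for s
  proof -
    have "omit s \<sigma> \<in> faces 4 \<sigma>"
      using that len by (simp add: omit_in_faces)
    with r show ?thesis by (fastforce simp: permitted_colorings_def)
  qed
  then obtain \<nu> \<eta> where rep: "\<And>s. s < 6 \<Longrightarrow> \<nu> s \<in> r\<^sub>1 (omit s \<sigma>) \<and> \<eta> s \<in> r\<^sub>2 (omit s \<sigma>)"
    by metis
  have "Q_cochain (omit s \<sigma>) (restrict \<omega> (faces 3 (omit s \<sigma>)))
      (restrict r\<^sub>1 (faces 4 (omit s \<sigma>)), restrict r\<^sub>2 (faces 4 (omit s \<sigma>)))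
      = Q (restrict \<omega> (faces 3 (omit s \<sigma>))) (omit s \<sigma>) (\<nu> s) (\<eta> s)" if s: "s < 6" for s
  proof (rule Q_cochain_eq)
    \<comment> \<open>A 4-simplex is its own 4-face (\<open>self\<close>), so a coloring restricted
      to the 4-faces of the face keeps its value there instead of becoming
      \<open>undefined\<close>.\<close>
    have \<tau>: "omit s \<sigma> \<in> faces 4 \<sigma>" and self: "omit s \<sigma> \<in> faces 4 (omit s \<sigma>)"
      using s len by (simp_all add: omit_in_faces self_in_faces length_omit)
    show "length (omit s \<sigma>) = 5"
      using s len by (simp add: length_omit)
    show "restrict \<omega> (faces 3 (omit s \<sigma>)) \<rho> \<noteq> 0" if "\<rho> \<in> faces 3 (omit s \<sigma>)" for \<rho>
      using that \<omega> faces_trans[OF \<tau>] by (auto simp: nowhere_zero_cocycles_def)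
    show "restrict r\<^sub>1 (faces 4 (omit s \<sigma>)) (omit s \<sigma>)
        \<in> colors (restrict \<omega> (faces 3 (omit s \<sigma>))) (omit s \<sigma>)"
      and "restrict r\<^sub>2 (faces 4 (omit s \<sigma>)) (omit s \<sigma>)
        \<in> colors (restrict \<omega> (faces 3 (omit s \<sigma>))) (omit s \<sigma>)"
      using self r \<tau> by (simp_all add: colors_restrict permitted_coloringsD)
    show "\<nu> s \<in> restrict r\<^sub>1 (faces 4 (omit s \<sigma>)) (omit s \<sigma>)"
      and "\<eta> s \<in> restrict r\<^sub>2 (faces 4 (omit s \<sigma>)) (omit s \<sigma>)"
      using self rep[OF s] by simp_all
  qed
  then have "heptagon_coboundary Q_cochain \<sigma> \<omega> (r\<^sub>1, r\<^sub>2)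
      = (\<Sum>s<6. (- 1) ^ s * Q (restrict \<omega> (faces 3 (omit s \<sigma>))) (omit s \<sigma>) (\<nu> s) (\<eta> s))"
    by (simp add: heptagon_coboundary_def len)
  also have "\<dots> = 0"
    using len \<omega> r rep by (rule alternating_sum_Q_eq_0)
  finally show ?thesis .
qed

theorem proposition5:
  shows "(\<forall>(\<sigma> :: 'v::linorder list) (\<omega> :: 'v list \<Rightarrow> 'f::field) r\<^sub>1 r\<^sub>2 \<nu> \<eta>.
            simplex 4 \<sigma> \<longrightarrow> \<omega> \<in> nowhere_zero_cocycles \<sigma> \<longrightarrow>
            r\<^sub>1 \<in> permitted_colorings \<omega> \<sigma> \<longrightarrow> r\<^sub>2 \<in> permitted_colorings \<omega> \<sigma> \<longrightarrow>
            \<nu> \<in> r\<^sub>1 \<sigma> \<longrightarrow> \<eta> \<in> r\<^sub>2 \<sigma> \<longrightarrow> Q_cochain \<sigma> \<omega> (r\<^sub>1, r\<^sub>2) = Q \<omega> \<sigma> \<nu> \<eta>)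
    \<and> heptagon_cocycle 4 (Q_cochain :: ('v, 'f) heptagon_cochain)
    \<and> (\<forall>(\<sigma> :: 'v list) (\<omega> :: 'v list \<Rightarrow> 'f) r\<^sub>1 r\<^sub>2 \<nu> \<eta>.
            simplex 5 \<sigma> \<longrightarrow> \<omega> \<in> nowhere_zero_cocycles \<sigma> \<longrightarrow>
            r\<^sub>1 \<in> permitted_colorings \<omega> \<sigma> \<longrightarrow> r\<^sub>2 \<in> permitted_colorings \<omega> \<sigma> \<longrightarrow>
            (\<forall>s\<le>5. \<nu> s \<in> r\<^sub>1 (omit s \<sigma>) \<and> \<eta> s \<in> r\<^sub>2 (omit s \<sigma>)) \<longrightarrow>
            (\<Sum>s = 0..5. (- 1) ^ s *
               Q (restrict \<omega> (faces 3 (omit s \<sigma>))) (omit s \<sigma>) (\<nu> s) (\<eta> s)) = 0)"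
proof (intro conjI allI impI)
  fix \<sigma> :: "'v list" and \<omega> :: "'v list \<Rightarrow> 'f" and r\<^sub>1 r\<^sub>2 \<nu> \<eta>
  assume "simplex 4 \<sigma>" "\<omega> \<in> nowhere_zero_cocycles \<sigma>"
    and r: "r\<^sub>1 \<in> permitted_colorings \<omega> \<sigma>" "r\<^sub>2 \<in> permitted_colorings \<omega> \<sigma>"
    and rep: "\<nu> \<in> r\<^sub>1 \<sigma>" "\<eta> \<in> r\<^sub>2 \<sigma>"
  then have "length \<sigma> = 5" and "\<And>\<tau>. \<tau> \<in> faces 3 \<sigma> \<Longrightarrow> \<omega> \<tau> \<noteq> 0"
    by (simp_all add: simplex_def nowhere_zero_cocycles_def)
  then show "Q_cochain \<sigma> \<omega> (r\<^sub>1, r\<^sub>2) = Q \<omega> \<sigma> \<nu> \<eta>"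
    using r rep by (intro Q_cochain_eq) (simp_all add: permitted_coloringsD self_in_faces)
next
  show "heptagon_cocycle 4 (Q_cochain :: ('v, 'f) heptagon_cochain)"
    by (auto simp: heptagon_cocycle_def simplex_def intro: heptagon_coboundary_Q_cochain)
next
  fix \<sigma> :: "'v list" and \<omega> :: "'v list \<Rightarrow> 'f" and r\<^sub>1 r\<^sub>2 \<nu> \<eta>
  assume "simplex 5 \<sigma>" "\<omega> \<in> nowhere_zero_cocycles \<sigma>"
    and "r\<^sub>1 \<in> permitted_colorings \<omega> \<sigma>" "r\<^sub>2 \<in> permitted_colorings \<omega> \<sigma>"
    and "\<forall>s\<le>5. \<nu> s \<in> r\<^sub>1 (omit s \<sigma>) \<and> \<eta> s \<in> r\<^sub>2 (omit s \<sigma>)"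
  moreover have "{0..5} = {..<6::nat}" by auto
  ultimately show "(\<Sum>s = 0..5. (- 1) ^ s *
      Q (restrict \<omega> (faces 3 (omit s \<sigma>))) (omit s \<sigma>) (\<nu> s) (\<eta> s)) = 0"
    by (simp add: simplex_def alternating_sum_Q_eq_0)
qed

end
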